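(* Let $(B,L)$ be a Hadamard pair of sets of integers of size $N$ (each containing zero as first element), with scaling factor an integer $R\ge2$, such that the matrix associated with $(B,L)$ is equivalent to the $N\times N$ standard Hadamard matrix. Assume that all extreme cycles for $(B,L)$ are contained in $\mathbb{Z}$. Then $(B,L)$ has a complementary Hadamard pair of integers, i.e., there exists a Hadamard pair $(B',L')$ with scaling factor $R$ such that $(B,L)$ and $(B',L')$ are complementary.
   Context: Hadamard pair: for an integer $R\ge2$ and finite sets $B,L\subset\mathbb{Z}$ with $0\in B$, $0\in L$, $(B,L)$ is a Hadamard pair with scaling factor $R$ if $\#B=\#L=N$ and the matrix $\frac{1}{\sqrt N}\left(e^{2\pi i R^{-1}bl}\right)_{b\in B,l\in L}$ is unitary; this is the matrix associated with $(B,L)$. Equivalence: an $N\times N$ Hadamard matrix is a unitary matrix all of whose entries have absolute value $\frac1{\sqrt N}$. Hadamard matrices $H,H'$ are equivalent if there exist permutations $\pi,\rho$ of $\{1,\dots,N\}$ and unimodular complex numbers $c_1,\dots,c_N,d_1,\dots,d_N$ with $H'_{ij}=c_id_jH_{\pi(i)\rho(j)}$ for all $i,j$. The standard Hadamard matrix is $\frac1{\sqrt N}(e^{2\pi i\frac{jk}{N}})_{j,k=0}^{N-1}$. Extreme cycles: put $m_B(x)=\frac1N\sum_{b\in B}e^{2\pi i bx}$. A finite set $\{x_0,\dots,x_{r-1}\}\subset\mathbb{R}$ is a cycle for $L$ if there exist $l_0,\dots,l_{r-1}\in L$ with $\frac{x_0+l_0}{R}=x_1,\dots,\frac{x_{r-2}+l_{r-2}}{R}=x_{r-1},\frac{x_{r-1}+l_{r-1}}{R}=x_0$;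 it is extreme for $(B,L)$ if $|m_B(x_k)|=1$ for all $k$. Direct sum: sets $A,A'\subset\mathbb{R}$ have disjoint differences if $(A-A)\cap(A'-A')=\{0\}$; in this case $A\oplus A'=\{a+a':a\in A,a'\in A'\}$ (the sign $\oplus$ asserts disjoint differences). Complementary Hadamard pairs: two Hadamard pairs $(B,L)$, $(B',L')$ with the same scaling factor $R$ (of possibly different sizes) are complementary if (1) $B\oplus B'$ and $L\oplus L'$ are complete sets of representatives modulo $R$; (2) the extreme cycles for $(B,L)$ and the extreme cycles for $(B',L')$ are contained in $\mathbb{Z}$; (3) the greatest common divisor of the elements of $B\oplus B'$ is $1$. *)

theory Defs
  imports
    "Jordan_Normal_Form.Schur_Decomposition"
    "HOL-Combinatorics.Permutations"
    "HOL-Number_Theory.Cong"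
begin

section \<open>Hadamard matrices\<close>

text \<open>An \<open>N \<times> N\<close> matrix is a matrix with rows and columns indexed by \<open>0, \<dots>, N - 1\<close>.\<close>

definition unitary_mat :: "nat \<Rightarrow> complex mat \<Rightarrow> bool" where
  "unitary_mat N U \<longleftrightarrow>
     U \<in> carrier_mat N N \<and> U * mat_adjoint U = 1\<^sub>m N \<and> mat_adjoint U * U = 1\<^sub>m N"

definition hadamard_mat :: "nat \<Rightarrow> complex mat \<Rightarrow> bool" where
  "hadamard_mat N H \<longleftrightarrow>
     unitary_mat N H \<and> (\<forall>i<N. \<forall>j<N. cmod (H $$ (i, j)) = 1 / sqrt N)"

definition hadamard_equiv :: "nat \<Rightarrow> complex mat \<Rightarrow> complex mat \<Rightarrow> bool" where
  "hadamard_equiv N H H' \<longleftrightarrow>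
     hadamard_mat N H \<and> hadamard_mat N H' \<and>
     (\<exists>\<pi> \<rho>. \<exists>c d :: nat \<Rightarrow> complex.
        \<pi> permutes {..<N} \<and> \<rho> permutes {..<N} \<and>
        (\<forall>i<N. cmod (c i) = 1) \<and> (\<forall>j<N. cmod (d j) = 1) \<and>
        (\<forall>i<N. \<forall>j<N. H' $$ (i, j) = c i * d j * H $$ (\<pi> i, \<rho> j)))"

definition standard_hadamard_mat :: "nat \<Rightarrow> complex mat" where
  "standard_hadamard_mat N =
     mat N N (\<lambda>(j, k). cis (2 * pi * (real j * real k / real N)) / of_real (sqrt N))"

section \<open>Hadamard pairs\<close>

text \<open>The matrix of a pair of sets needs an enumeration of each set. We list \<open>0\<close> first
  and the remaining elements in increasing order. Another enumeration permutes rows and columns,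
  which affects neither unitarity nor the equivalence class.\<close>

definition zero_first :: "int set \<Rightarrow> int list" where
  "zero_first B = 0 # sorted_list_of_set (B - {0})"

definition pair_mat :: "int \<Rightarrow> int set \<Rightarrow> int set \<Rightarrow> complex mat" where
  "pair_mat R B L =
     mat (card B) (card L)
       (\<lambda>(i, j). cis (2 * pi * (of_int (zero_first B ! i * zero_first L ! j) / of_int R))
                 / of_real (sqrt (card B)))"

definition hadamard_pair :: "int \<Rightarrow> int set \<Rightarrow> int set \<Rightarrow> bool" where
  "hadamard_pair R B L \<longleftrightarrow>
     R \<ge> 2 \<and> finite B \<and> finite L \<and> 0 \<in> B \<and> 0 \<in> L \<and> card B = card L \<and>
     unitary_mat (card B) (pair_mat R B L)"

section \<open>Extreme cycles\<close>

definition mask :: "int set \<Rightarrow> real \<Rightarrow> complex" where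
  "mask B x = (\<Sum>b\<in>B. cis (2 * pi * (of_int b * x))) / of_nat (card B)"

text \<open>The points \<open>x 0, \<dots>, x (r - 1)\<close> need not be distinct.\<close>

definition is_cycle :: "int \<Rightarrow> int set \<Rightarrow> real set \<Rightarrow> bool" where
  "is_cycle R L C \<longleftrightarrow>
     (\<exists>r>0. \<exists>(x :: nat \<Rightarrow> real) (l :: nat \<Rightarrow> int).
        C = x ` {..<r} \<and>
        (\<forall>k<r. l k \<in> L \<and> (x k + of_int (l k)) / of_int R = x (Suc k mod r)))"

definition extreme_cycle :: "int \<Rightarrow> int set \<Rightarrow> int set \<Rightarrow> real set \<Rightarrow> bool" where
  "extreme_cycle R B L C \<longleftrightarrow> is_cycle R L C \<and> (\<forall>x\<in>C. cmod (mask B x) = 1)"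

section \<open>Complementary Hadamard pairs\<close>

definition disjoint_differences :: "'a::ab_group_add set \<Rightarrow> 'a set \<Rightarrow> bool" where
  "disjoint_differences A A' \<longleftrightarrow>
     {a - b | a b. a \<in> A \<and> b \<in> A} \<inter> {a - b | a b. a \<in> A' \<and> b \<in> A'} = {0}"

text \<open>This is the plain sumset; wherever it stands for a direct sum, the condition
  \<^const>\<open>disjoint_differences\<close> is stated separately.\<close>

definition direct_sum :: "'a::ab_group_add set \<Rightarrow> 'a set \<Rightarrow> 'a set" where
  "direct_sum A A' = {a + a' | a a'. a \<in> A \<and> a' \<in> A'}"

definition complete_representatives :: "int \<Rightarrow> int set \<Rightarrow> bool" where
  "complete_representatives R S \<longleftrightarrow> (\<forall>n. \<exists>!s. s \<in> S \<and> [s = n] (mod R))"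

definition complementary ::
  "int \<Rightarrow> int set \<Rightarrow> int set \<Rightarrow> int set \<Rightarrow> int set \<Rightarrow> bool" where
  "complementary R B L B' L' \<longleftrightarrow>
     hadamard_pair R B L \<and> hadamard_pair R B' L' \<and>
     disjoint_differences B B' \<and> complete_representatives R (direct_sum B B') \<and>
     disjoint_differences L L' \<and> complete_representatives R (direct_sum L L') \<and>
     (\<forall>C. extreme_cycle R B L C \<longrightarrow> C \<subseteq> \<int>) \<and>
     (\<forall>C. extreme_cycle R B' L' C \<longrightarrow> C \<subseteq> \<int>) \<and>
     Gcd (direct_sum B B') = 1"

end

theory Submission
  imports Defs
begin

text \<open>Comparing the matrix with the standard one after normalising the row and the column of zero
  gives \<open>R = N M\<close> and \<open>M dvd b * l\<close> for all \<open>b \<in> B\<close>, \<open>l \<in> L\<close>. Hence \<open>M = g h\<close> with \<open>g\<close>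
  dividing \<open>B\<close> and \<open>h\<close> dividing \<open>L\<close>, and the elements of \<open>B / g\<close> and of \<open>L / h\<close> are
  pairwise incongruent modulo \<open>N\<close>. The complementary pair is then
  \<open>B' = {0..<g} + g N {0..<h}\<close>, \<open>L' = {0..<h} + h N {0..<g}\<close>: its exponential sums split into two
  full sums of roots of unity. The hypothesis on extreme cycles is needed only for \<open>g = h = 1\<close>, when
  \<open>B' = {0}\<close>. There \<open>d = Gcd B\<close> is prime to \<open>R\<close> and \<open>L\<close> represents all residues, so every integer
  \<open>z\<close> has a successor \<open>(z + d l) / R\<close>; starting at \<open>1\<close> one ends in a cycle of integers prime to
  \<open>d\<close>, which divided by \<open>d\<close> is an extreme cycle, whence \<open>d = 1\<close>.\<close>

section \<open>Sums of roots of unity\<close>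

lemma cis_2pi_eq_1_iff: "cis (2 * pi * x) = 1 \<longleftrightarrow> x \<in> \<int>"
proof
  assume "cis (2 * pi * x) = 1"
  then have "cos (2 * pi * x) = 1"
    by (metis cis.sel(1) one_complex.sel(1))
  then obtain n :: int where "2 * pi * x = of_int n * 2 * pi"
    by (auto simp: cos_one_2pi_int)
  then have "x = of_int n"
    by simp
  then show "x \<in> \<int>"
    by simp
next
  assume "x \<in> \<int>"
  then show "cis (2 * pi * x) = 1"
    by (simp add: cis_multiple_2pi)
qed

lemma of_int_div_in_Ints_iff:
  fixes a b :: int
  assumes "b \<noteq> 0"
  shows "(of_int a / of_int b :: real) \<in> \<int> \<longleftrightarrow> b dvd a"
proof
  assume "(of_int a / of_int b :: real) \<in> \<int>"
  then obtain n where "(of_int a / of_int b :: real) = of_int n"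
    by (auto elim: Ints_cases)
  then have "(of_int a :: real) = of_int (n * b)"
    using assms by (simp add: field_simps)
  then have "a = n * b"
    by (simp only: of_int_eq_iff)
  then show "b dvd a"
    by simp
next
  assume "b dvd a"
  then show "(of_int a / of_int b :: real) \<in> \<int>"
    using assms by (auto elim!: dvdE)
qed

text \<open>A geometric sum whose ratio \<open>?w\<close> satisfies \<open>?w ^ n = 1\<close>; the
  divisibility assumption keeps \<open>?w\<close> away from \<open>1\<close>.\<close>

lemma sum_roots_of_unity:
  fixes t :: int and n :: nat
  assumes "\<not> int n dvd t" "n > 0"
  shows "(\<Sum>k<n. cis (2 * pi * (of_int (int k * t) / of_nat n))) = 0"
proof -
  let ?w = "cis (2 * pi * (of_int t / of_nat n))"
  have w: "?w \<noteq> 1"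
    using assms of_int_div_in_Ints_iff[of "int n" t] unfolding cis_2pi_eq_1_iff by simp
  have pow: "cis (2 * pi * (of_int (int k * t) / of_nat n)) = ?w ^ k" for k
    by (simp add: DeMoivre algebra_simps)
  have "?w ^ n = cis (2 * pi * of_int t)"
    using assms(2) by (simp add: DeMoivre)
  then have "?w ^ n = 1"
    by (simp add: cis_2pi_eq_1_iff)
  then show ?thesis
    using w unfolding pow by (simp add: geometric_sum)
qed

section \<open>Hadamard pairs\<close>

lemma zero_first:
  assumes "finite B" "0 \<in> B"
  shows "set (zero_first B) = B" "distinct (zero_first B)" "length (zero_first B) = card B"
    "zero_first B ! 0 = 0"
proof -
  show *: "set (zero_first B) = B" "distinct (zero_first B)" "zero_first B ! 0 = 0"
    using assms by (auto simp: zero_first_def)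
  show "length (zero_first B) = card B"
    using distinct_card[OF *(2)] *(1) by simp
qed

lemma bij_betw_zero_first:
  assumes "finite B" "0 \<in> B"
  shows "bij_betw ((!) (zero_first B)) {..<card B} B"
  using bij_betw_nth[OF zero_first(2)[OF assms], of "{..<card B}" B] zero_first[OF assms] by simp

text \<open>Orthogonal columns make the adjoint a left inverse, and for square matrices a one-sided
  inverse is two-sided. This reduces the Hadamard property to vanishing exponential sums over
  \<open>B\<close>.\<close>

lemma hadamard_pairI:
  assumes R: "R \<ge> 2" and fin: "finite B" "finite L" and zero: "0 \<in> B" "0 \<in> L"
    and card: "card B = card L"
    and orth: "\<And>l l'. l \<in> L \<Longrightarrow> l' \<in> L \<Longrightarrow> l \<noteq> l' \<Longrightarrow>
      (\<Sum>b\<in>B. cis (2 * pi * (of_int (b * (l' - l)) / of_int R))) = 0"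
  shows "hadamard_pair R B L"
proof -
  let ?N = "card B" and ?U = "pair_mat R B L"
  have U: "?U \<in> carrier_mat ?N ?N"
    by (simp add: pair_mat_def card)
  have N: "?N > 0"
    using fin zero by (auto simp: card_gt_0_iff)
  note bij = bij_betw_zero_first[OF fin(1) zero(1)]
  have "mat_adjoint ?U * ?U = 1\<^sub>m ?N"
  proof (rule eq_matI)
    fix i j assume "i < dim_row (1\<^sub>m ?N :: complex mat)" "j < dim_col (1\<^sub>m ?N :: complex mat)"
    then have ij: "i < ?N" "j < ?N"
      by auto
    define l where "l = zero_first L ! i"
    define l' where "l' = zero_first L ! j"
    have lL: "l \<in> L" "l' \<in> L"
      using ij zero_first[OF fin(2) zero(2)] card unfolding l_def l'_def by (metis nth_mem)+
    have leq: "l = l' \<longleftrightarrow> i = j"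
      using ij zero_first[OF fin(2) zero(2)] card unfolding l_def l'_def
      by (simp add: nth_eq_iff_index_eq)
    have prod: "cnj (cis (2 * pi * (of_int (b * l) / of_int R)) / of_real (sqrt ?N)) *
        (cis (2 * pi * (of_int (b * l') / of_int R)) / of_real (sqrt ?N)) =
        cis (2 * pi * (of_int (b * (l' - l)) / of_int R)) / of_nat ?N" for b
    proof -
      have "cnj (cis (2 * pi * (of_int (b * l) / of_int R))) *
          cis (2 * pi * (of_int (b * l') / of_int R)) =
          cis (2 * pi * (of_int (b * (l' - l)) / of_int R))"
        by (simp add: cis_cnj cis_mult algebra_simps diff_divide_distrib)
      moreover have "complex_of_real (sqrt ?N) * of_real (sqrt ?N) = of_nat ?N"
        by (metis of_nat_0_le_iff of_real_mult of_real_of_nat_eq real_sqrt_mult_self abs_of_nonneg)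
      ultimately show ?thesis
        by (simp del: of_int_mult)
    qed
    have "(mat_adjoint ?U * ?U) $$ (i, j) = (\<Sum>k<?N. cnj (?U $$ (k, i)) * ?U $$ (k, j))"
      using ij U by (simp add: scalar_prod_def mat_adjoint_def mat_of_rows_def atLeast0LessThan)
    also have "\<dots> = (\<Sum>k<?N. cis (2 * pi *
        (of_int (zero_first B ! k * (l' - l)) / of_int R)) / of_nat ?N)"
      by (intro sum.cong refl)
        (use ij card prod in \<open>simp add: pair_mat_def l_def l'_def del: of_int_mult\<close>)
    also have "\<dots> = (\<Sum>b\<in>B. cis (2 * pi * (of_int (b * (l' - l)) / of_int R)) / of_nat ?N)"
      by (rule sum.reindex_bij_betw[OF bij])
    also have "\<dots> = (\<Sum>b\<in>B. cis (2 * pi * (of_int (b * (l' - l)) / of_int R))) / of_nat ?N"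
      by (simp add: sum_divide_distrib)
    also have "\<dots> = (if i = j then 1 else 0)"
      using orth[OF lL] leq N by auto
    finally show "(mat_adjoint ?U * ?U) $$ (i, j) = 1\<^sub>m ?N $$ (i, j)"
      using ij by simp
  qed (use U in \<open>auto simp: mat_adjoint_def mat_of_rows_def\<close>)
  moreover have "mat_adjoint ?U \<in> carrier_mat ?N ?N"
    using U by (auto simp: mat_adjoint_def mat_of_rows_def)
  ultimately have "unitary_mat ?N ?U"
    using U mat_mult_left_right_inverse unfolding unitary_mat_def by blast
  then show ?thesis
    using R fin zero card by (simp add: hadamard_pair_def)
qed

section \<open>Arithmetic of pairs whose matrix is equivalent to the standard one\<close>

text \<open>The permutations become the enumerations \<open>\<beta>\<close>,
  \<open>\<gamma>\<close>, and \<open>p\<close>, \<open>q\<close> are chosen as the positions of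
  \<open>0\<close> in them. The congruence expresses that \<open>\<beta> i * \<gamma> j / R\<close>
  and \<open>(i - p) * (j - q) / N\<close> differ by an integer, with denominators cleared by
  \<open>R * N\<close>.\<close>

lemma standard_equiv_exponents:
  assumes pair: "hadamard_pair R B L" and N: "card B = N"
    and equiv: "hadamard_equiv N (pair_mat R B L) (standard_hadamard_mat N)"
  obtains \<beta> \<gamma> :: "nat \<Rightarrow> int" and p q :: nat
  where "bij_betw \<beta> {..<N} B" "bij_betw \<gamma> {..<N} L" "p < N" "q < N"
    "\<And>i j. i < N \<Longrightarrow> j < N \<Longrightarrow>
      [int N * (\<beta> i * \<gamma> j) = R * ((int i - int p) * (int j - int q))] (mod R * int N)"
proof -
  have R: "R \<ge> 2" and fin: "finite B" "finite L" and zero: "0 \<in> B" "0 \<in> L" and L: "card L = N"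
    using pair N by (auto simp: hadamard_pair_def)
  have N0: "N > 0"
    using fin zero N by (auto simp: card_gt_0_iff)
  obtain \<pi> \<rho> :: "nat \<Rightarrow> nat" and c d :: "nat \<Rightarrow> complex"
    where perm: "\<pi> permutes {..<N}" "\<rho> permutes {..<N}"
      and cd: "\<And>i. i < N \<Longrightarrow> cmod (c i) = 1" "\<And>j. j < N \<Longrightarrow> cmod (d j) = 1"
      and eq: "\<And>i j. i < N \<Longrightarrow> j < N \<Longrightarrow> standard_hadamard_mat N $$ (i, j) =
        c i * d j * pair_mat R B L $$ (\<pi> i, \<rho> j)"
    using equiv unfolding hadamard_equiv_def by blast
  define \<beta> where "\<beta> i = zero_first B ! \<pi> i" for i
  define \<gamma> where "\<gamma> j = zero_first L ! \<rho> j" for j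
  have bij: "bij_betw \<beta> {..<N} B" "bij_betw \<gamma> {..<N} L"
    using bij_betw_trans[OF permutes_imp_bij[OF perm(1)] bij_betw_zero_first[OF fin(1) zero(1), unfolded N]]
      bij_betw_trans[OF permutes_imp_bij[OF perm(2)] bij_betw_zero_first[OF fin(2) zero(2), unfolded L]]
    by (simp_all add: \<beta>_def \<gamma>_def comp_def cong: bij_betw_cong)
  obtain p q where pq: "p < N" "\<beta> p = 0" "q < N" "\<gamma> q = 0"
    using bij zero unfolding bij_betw_def by (metis imageE lessThan_iff)
  have lt: "\<pi> i < N" "\<rho> i < N" if "i < N" for i
    using permutes_in_image[OF perm(1), of i] permutes_in_image[OF perm(2), of i] that by auto
  have eq': "cis (2 * pi * (real i * real j / real N)) =
      c i * d j * cis (2 * pi * (of_int (\<beta> i * \<gamma> j) / of_int R))" if "i < N" "j < N" for i j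
    using eq[OF that] that lt N0
    by (simp add: standard_hadamard_mat_def pair_mat_def \<beta>_def \<gamma>_def N L)
  have "[int N * (\<beta> i * \<gamma> j) = R * ((int i - int p) * (int j - int q))] (mod R * int N)"
    if ij: "i < N" "j < N" for i j
  proof -
    let ?e = "\<lambda>a b :: nat. real a * real b / real N"
    let ?s = "of_int (\<beta> i * \<gamma> j) / of_int R :: real"
    have nz: "c a \<noteq> 0" "d a \<noteq> 0" if "a < N" for a
      using cd[OF that] by auto
    \<comment> \<open>The unimodular factors cancel in a cross ratio with the row and the column of zero.\<close>
    have "cis (2 * pi * ?e i j) * cis (2 * pi * ?e p q) =
        cis (2 * pi * ?e i q) * cis (2 * pi * ?e p j) * cis (2 * pi * ?s)"
      unfolding eq'[OF ij] eq'[OF pq(1,3)] eq'[OF ij(1) pq(3)] eq'[OF pq(1) ij(2)] pq(2,4)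
      by (simp del: of_int_mult)
    then have "cis (2 * pi * (?e i j + ?e p q)) = cis (2 * pi * (?e i q + ?e p j + ?s))"
      by (simp only: cis_mult distrib_left)
    then have "cis (2 * pi * (?e i j + ?e p q)) / cis (2 * pi * (?e i q + ?e p j + ?s)) = 1"
      by (metis cis_neq_zero divide_self)
    then have "cis (2 * pi * ((?e i j + ?e p q) - (?e i q + ?e p j + ?s))) = 1"
      by (simp only: cis_divide right_diff_distrib)
    then have "(?e i j + ?e p q) - (?e i q + ?e p j + ?s) \<in> \<int>"
      by (simp only: cis_2pi_eq_1_iff)
    moreover have "(?e i j + ?e p q) - (?e i q + ?e p j + ?s) =
        of_int (R * ((int i - int p) * (int j - int q)) - int N * (\<beta> i * \<gamma> j)) /
        of_int (R * int N)"
      using R N0 by (simp add: field_simps)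
    ultimately have "R * int N dvd R * ((int i - int p) * (int j - int q)) - int N * (\<beta> i * \<gamma> j)"
      using R N0 of_int_div_in_Ints_iff by (metis mult_eq_0_iff not_numeral_le_zero of_nat_eq_0_iff less_irrefl)
    then show ?thesis
      by (simp add: cong_iff_dvd_diff dvd_diff_commute)
  qed
  then show thesis
    using that bij pq by blast
qed

text \<open>The product of the two gcds is the gcd of all products; one factor at a time is pulled
  out of the gcd.\<close>

lemma dvd_Gcd_mult_Gcd:
  fixes A B :: "int set"
  assumes "\<And>a b. a \<in> A \<Longrightarrow> b \<in> B \<Longrightarrow> m dvd a * b"
  shows "m dvd Gcd A * Gcd B"
proof -
  have "m dvd a * Gcd B" if "a \<in> A" for a
  proof -
    have "m dvd Gcd ((*) a ` B)"
      using assms that by (auto intro: Gcd_greatest)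
    then show ?thesis
      by (simp add: Gcd_mult)
  qed
  then have "m dvd Gcd ((*) (Gcd B) ` A)"
    by (auto intro!: Gcd_greatest simp: mult.commute)
  then show ?thesis
    by (simp only: Gcd_mult dvd_normalize_iff mult.commute)
qed

text \<open>Modulo \<open>R\<close>, the product in place \<open>(i, j)\<close> is
  \<open>M * (i - p) * (j - q)\<close>, so a row and a column whose index factor is \<open>1\<close>
  recover all indices modulo \<open>N\<close>. The elements \<open>b0\<close>, \<open>l0\<close> sit
  in that row and column; their product later shows that \<open>b0\<close> is prime to
  \<open>N\<close> when \<open>g = 1\<close>.\<close>

lemma standard_equiv_structure:
  assumes pair: "hadamard_pair R B L" and N: "card B = N"
    and equiv: "hadamard_equiv N (pair_mat R B L) (standard_hadamard_mat N)"
  obtains g h :: nat and b0 l0 :: int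
  where "g > 0" "h > 0" "R = int (N * g * h)"
    "\<And>b. b \<in> B \<Longrightarrow> int g dvd b" "\<And>l. l \<in> L \<Longrightarrow> int h dvd l"
    "b0 \<in> B" "l0 \<in> L" "[b0 * l0 = int (g * h)] (mod R)"
    "\<And>b b'. b \<in> B \<Longrightarrow> b' \<in> B \<Longrightarrow> [b = b'] (mod int (g * N)) \<Longrightarrow> b = b'"
    "\<And>l l'. l \<in> L \<Longrightarrow> l' \<in> L \<Longrightarrow> [l = l'] (mod int (h * N)) \<Longrightarrow> l = l'"
proof -
  have R: "R \<ge> 2"
    using pair by (auto simp: hadamard_pair_def)
  obtain \<beta> \<gamma> :: "nat \<Rightarrow> int" and p q :: nat
    where bij: "bij_betw \<beta> {..<N} B" "bij_betw \<gamma> {..<N} L" and pq: "p < N" "q < N"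
      and cong: "\<And>i j. i < N \<Longrightarrow> j < N \<Longrightarrow>
        [int N * (\<beta> i * \<gamma> j) = R * ((int i - int p) * (int j - int q))] (mod R * int N)"
    using standard_equiv_exponents[OF assms] by blast
  have N0: "N > 0"
    using pq by simp
  \<comment> \<open>The cyclic successor of the position of zero: its index difference is
    \<open>1\<close> modulo \<open>N\<close> even when \<open>p = N - 1\<close>.\<close>
  define i1 where "i1 = Suc p mod N"
  define j1 where "j1 = Suc q mod N"
  have lt: "i1 < N" "j1 < N"
    using N0 by (auto simp: i1_def j1_def)
  have one: "[int i1 - int p = 1] (mod int N)" "[int j1 - int q = 1] (mod int N)"
    unfolding i1_def j1_def by (simp_all add: cong_def zmod_int mod_diff_left_eq)
  have one': "[(int i1 - int p) * (int j1 - int q) = 1] (mod int N)"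
    using cong_mult[OF one] by simp
  \<comment> \<open>Modulo \<open>N\<close> the left side of the congruence vanishes, while the
    index product is a unit.\<close>
  have "int N dvd R * ((int i1 - int p) * (int j1 - int q))"
    using cong_dvd_iff[OF cong_dvd_modulus[OF cong[OF lt], of "int N"]] by simp
  moreover have "coprime (int N) ((int i1 - int p) * (int j1 - int q))"
    using cong_imp_coprime[OF cong_sym[OF one']] by (simp add: coprime_commute)
  ultimately have "int N dvd R"
    by (simp add: coprime_dvd_mult_left_iff)
  then obtain M where M: "R = int N * M"
    by (auto elim: dvdE)
  have M0: "M > 0"
    using M R N0 by (simp add: zero_less_mult_iff) (metis M R zero_less_mult_pos of_nat_0_less_iff zero_less_numeral order_less_le_trans)
  have cong': "[\<beta> i * \<gamma> j = M * ((int i - int p) * (int j - int q))] (mod R)"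
    if "i < N" "j < N" for i j
  proof -
    have "int N * R dvd int N * (\<beta> i * \<gamma> j - M * ((int i - int p) * (int j - int q)))"
      using cong[OF that] by (simp add: M cong_iff_dvd_diff algebra_simps)
    then show ?thesis
      using N0 by (simp add: cong_iff_dvd_diff)
  qed
  have "M dvd b * l" if bl: "b \<in> B" "l \<in> L" for b l
  proof -
    obtain i j where "i < N" "j < N" "b = \<beta> i" "l = \<gamma> j"
      using bl bij unfolding bij_betw_def by auto
    then have "[b * l = M * ((int i - int p) * (int j - int q))] (mod M)"
      using cong' cong_dvd_modulus[of _ _ R M] M by (metis dvd_triv_right)
    then show ?thesis
      by (simp add: cong_dvd_iff)
  qed
  then have "M dvd Gcd B * Gcd L"
    by (rule dvd_Gcd_mult_Gcd)
  \<comment> \<open>A divisor of a product splits into divisors of the two factors. These may be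
    negative; since \<open>M > 0\<close>, passing to absolute values preserves their
    product.\<close>
  then obtain g' h' where gh': "M = g' * h'" "g' dvd Gcd B" "h' dvd Gcd L"
    using division_decomp by blast
  define g where "g = nat \<bar>g'\<bar>"
  define h where "h = nat \<bar>h'\<bar>"
  have Mgh: "M = int (g * h)"
    using gh'(1) M0 unfolding g_def h_def by (simp flip: abs_mult)
  have g: "g > 0" and h: "h > 0"
    using Mgh M0 by (auto intro: gr0I)
  have Rgh: "R = int (N * g * h)"
    using M Mgh by simp
  have gB: "int g dvd b" if "b \<in> B" for b
    using gh'(2) that unfolding g_def by (simp add: dvd_trans)
  have hL: "int h dvd l" if "l \<in> L" for l
    using gh'(3) that unfolding h_def by (simp add: dvd_trans)
  have mem: "\<beta> i1 \<in> B" "\<gamma> j1 \<in> L"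
    using bij lt by (auto simp: bij_betw_def)
  have MN: "[M * x = M * y] (mod R) \<longleftrightarrow> [x = y] (mod int N)" for x y
    using M0 by (simp add: M cong_iff_dvd_diff mult.commute[of _ M] flip: right_diff_distrib)
  \<comment> \<open>The index factor of column \<open>j1\<close> is \<open>1\<close>, so this column
    determines \<open>i\<close> modulo \<open>N\<close>.\<close>
  have colB: "[\<beta> i * \<gamma> j1 = M * (int i - int p)] (mod R)" if "i < N" for i
    using cong'[OF that lt(2)] cong_mult[OF cong_refl one(2), of "int i - int p"] MN cong_trans
    by (metis mult.right_neutral)
  have rowL: "[\<beta> i1 * \<gamma> j = M * (int j - int q)] (mod R)" if "j < N" for j
    using cong'[OF lt(1) that] cong_mult[OF one(1) cong_refl, of "int j - int q"] MN cong_trans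
    by (metis mult_1)
  have idx: "i = i'" if "[int i - int s = int i' - int s] (mod int N)" "i < N" "i' < N" for i i' s :: nat
  proof -
    have "[int i = int i'] (mod int N)"
      using that(1) by (simp add: cong_iff_dvd_diff)
    then show ?thesis
      using that by (simp add: cong_int_iff cong_less_modulus_unique_nat)
  qed
  show thesis
  proof (rule that[OF g h Rgh gB hL mem])
    show "[\<beta> i1 * \<gamma> j1 = int (g * h)] (mod R)"
      using cong'[OF lt] one' MN[of _ 1] Mgh by (metis cong_trans mult.right_neutral)
  next
    fix b b' assume b: "b \<in> B" "b' \<in> B" and c: "[b = b'] (mod int (g * N))"
    obtain i i' where i: "i < N" "i' < N" "b = \<beta> i" "b' = \<beta> i'"
      using b bij unfolding bij_betw_def by auto
    \<comment> \<open>The factor \<open>h\<close> of \<open>\<gamma> j1\<close> lifts agreement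
      modulo \<open>g * N\<close> to agreement modulo \<open>R\<close> in column
      \<open>j1\<close>.\<close>
    have "int (g * N) * int h dvd (b - b') * \<gamma> j1"
      using c hL[OF mem(2)] unfolding cong_iff_dvd_diff by (rule mult_dvd_mono)
    then have "[b * \<gamma> j1 = b' * \<gamma> j1] (mod R)"
      by (simp add: cong_iff_dvd_diff Rgh algebra_simps)
    then have "[M * (int i - int p) = M * (int i' - int p)] (mod R)"
      using colB i by (metis cong_sym cong_trans)
    then show "b = b'"
      using i idx MN by blast
  next
    fix l l' assume l: "l \<in> L" "l' \<in> L" and c: "[l = l'] (mod int (h * N))"
    obtain j j' where j: "j < N" "j' < N" "l = \<gamma> j" "l' = \<gamma> j'"
      using l bij unfolding bij_betw_def by auto
    have "int g * int (h * N) dvd \<beta> i1 * (l - l')"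
      using gB[OF mem(1)] c unfolding cong_iff_dvd_diff by (rule mult_dvd_mono)
    then have "[\<beta> i1 * l = \<beta> i1 * l'] (mod R)"
      by (simp add: cong_iff_dvd_diff Rgh algebra_simps)
    then have "[M * (int j - int q) = M * (int j' - int q)] (mod R)"
      using rowL j by (metis cong_sym cong_trans)
    then show "l = l'"
      using j idx MN by blast
  qed
qed

section \<open>The complementary pair\<close>

text \<open>In mixed radix with digit sizes \<open>g\<close>, \<open>N\<close>, \<open>h\<close>
  from the lowest up, the block carries the lowest and the highest digit. Multiples of
  \<open>g\<close> that are distinct modulo \<open>g * N\<close> account for the middle one.
  Exchanging \<open>g\<close> and \<open>h\<close> gives the complement of \<open>L\<close>.\<close>

definition block :: "nat \<Rightarrow> nat \<Rightarrow> nat \<Rightarrow> int set" where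
  "block N g h = (\<lambda>(i, j). int i + int (g * N) * int j) ` ({..<g} \<times> {..<h})"

lemma mod_block_element:
  fixes i j g N :: nat
  assumes "i < g"
  shows "(int i + int (g * N) * int j) mod int g = int i"
  using assms by (simp add: mult.assoc)

lemma inj_block:
  assumes "N > 0"
  shows "inj_on (\<lambda>(i, j). int i + int (g * N) * int j) ({..<g} \<times> {..<h})"
proof (rule inj_onI, clarify)
  fix i j i' j' assume "i < g" "i' < g" "j < h" "j' < h"
    and eq: "int i + int (g * N) * int j = int i' + int (g * N) * int j'"
  then have "i = i'"
    using mod_block_element[of i g N j] mod_block_element[of i' g N j'] by simp
  then show "i = i' \<and> j = j'"
    using eq \<open>i < g\<close> assms by auto
qed

lemma
  assumes "N > 0"
  shows finite_block: "finite (block N g h)"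
    and card_block: "card (block N g h) = g * h"
  using card_image[OF inj_block[OF assms, of g h]] by (simp_all add: block_def card_cartesian_product)

lemma block_memI: "i < g \<Longrightarrow> j < h \<Longrightarrow> int i + int (g * N) * int j \<in> block N g h"
  by (force simp: block_def)

lemma zero_in_block: "g > 0 \<Longrightarrow> h > 0 \<Longrightarrow> 0 \<in> block N g h"
  using block_memI[of 0 g 0 h N] by simp

lemma block_memE:
  assumes "x \<in> block N g h"
  obtains i j where "i < g" "j < h" "x = int i + int (g * N) * int j"
  using assms by (auto simp: block_def)

lemma hadamard_pair_block:
  assumes R: "int (N * g * h) \<ge> 2"
  shows "hadamard_pair (int (N * g * h)) (block N g h) (block N h g)"
proof (rule hadamard_pairI[OF R])
  have pos: "N > 0" "g > 0" "h > 0"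
    using R by (auto intro!: gr0I)
  show "finite (block N g h)" "finite (block N h g)" "0 \<in> block N g h" "0 \<in> block N h g"
    "card (block N g h) = card (block N h g)"
    using pos by (auto simp: finite_block card_block zero_in_block)
  fix l l' assume l: "l \<in> block N h g" and l': "l' \<in> block N h g" and neq: "l \<noteq> l'"
  define t where "t = l' - l"
  let ?e = "\<lambda>x :: real. cis (2 * pi * x)"
  \<comment> \<open>The high digit contributes
    \<open>g * N * j * t / (N * g * h) = j * t / h\<close>, so the double sum factors.\<close>
  have split: "?e (of_int ((int i + int (g * N) * int j) * t) / of_int (int (N * g * h))) =
      ?e (of_int (int i * t) / of_int (int (N * g * h))) * ?e (of_int (int j * t) / of_nat h)" for i j
    using pos by (simp add: cis_mult field_simps)
  have "(\<Sum>b\<in>block N g h. ?e (of_int (b * t) / of_int (int (N * g * h)))) =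
      (\<Sum>i<g. \<Sum>j<h. ?e (of_int ((int i + int (g * N) * int j) * t) / of_int (int (N * g * h))))"
    unfolding block_def sum.reindex[OF inj_block[OF pos(1)]] sum.cartesian_product
    by (simp add: comp_def case_prod_unfold)
  also have "\<dots> = (\<Sum>i<g. ?e (of_int (int i * t) / of_int (int (N * g * h)))) *
      (\<Sum>j<h. ?e (of_int (int j * t) / of_nat h))"
    unfolding split by (simp add: sum_product)
  also have "\<dots> = 0"
  \<comment> \<open>Unless \<open>h\<close> divides \<open>t\<close>, the sum over \<open>j\<close>
    vanishes. If it does, the low digits of \<open>l\<close> and \<open>l'\<close> agree,
    \<open>t\<close> is a multiple of \<open>h * N\<close>, and the sum over \<open>i\<close>
    becomes a vanishing sum of \<open>g\<close>-th roots of unity.\<close>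
  proof (cases "int h dvd t")
    case False
    then show ?thesis
      using sum_roots_of_unity pos by simp
  next
    case True
    obtain k m where km: "k < h" "m < g" "l = int k + int (h * N) * int m"
      using l by (rule block_memE)
    obtain k' m' where km': "k' < h" "m' < g" "l' = int k' + int (h * N) * int m'"
      using l' by (rule block_memE)
    have "l' mod int h = l mod int h"
      using True unfolding t_def by (simp add: mod_eq_dvd_iff)
    then have "k' = k"
      using mod_block_element km km' by simp
    then have t: "t = int (h * N) * (int m' - int m)" and "m \<noteq> m'"
      using neq km km' by (auto simp: t_def algebra_simps)
    then have "\<not> int g dvd int m' - int m"
      using km km' by (auto simp flip: mod_eq_dvd_iff)
    then have "(\<Sum>i<g. ?e (of_int (int i * (int m' - int m)) / of_nat g)) = 0"
      using sum_roots_of_unity pos by blast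
    moreover have "of_int (int i * t) / of_int (int (N * g * h)) =
        (of_int (int i * (int m' - int m)) / of_nat g :: real)" for i
      using pos by (simp add: t field_simps)
    ultimately show ?thesis
      by simp
  qed
  finally show "(\<Sum>b\<in>block N g h.
      ?e (of_int (b * (l' - l)) / of_int (int (N * g * h)))) = 0"
    by (simp add: t_def)
qed

section \<open>Direct sums as complete residue systems\<close>

lemma complete_representativesI:
  assumes R: "R > 0" and card: "card S = nat R"
    and inj: "\<And>s t. s \<in> S \<Longrightarrow> t \<in> S \<Longrightarrow> [s = t] (mod R) \<Longrightarrow> s = t"
  shows "complete_representatives R S"
proof -
  have "inj_on (\<lambda>s. s mod R) S"
    using inj by (auto simp: inj_on_def cong_def)
  \<comment> \<open>Pigeonhole: an injective map into the \<open>R\<close> residues from a set of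
    \<open>R\<close> elements is onto.\<close>
  then have "card ((\<lambda>s. s mod R) ` S) = card {0..<R}"
    using card card_image by fastforce
  moreover have "(\<lambda>s. s mod R) ` S \<subseteq> {0..<R}"
    using R by auto
  ultimately have img: "(\<lambda>s. s mod R) ` S = {0..<R}"
    by (simp add: card_subset_eq)
  have "\<exists>s\<in>S. [s = n] (mod R)" for n
  proof -
    have "n mod R \<in> (\<lambda>s. s mod R) ` S"
      using R by (simp add: img)
    then show ?thesis
      by (auto simp: cong_def)
  qed
  then show ?thesis
    unfolding complete_representatives_def using inj by (metis cong_sym cong_trans)
qed

text \<open>Uniqueness of sums modulo \<open>R\<close> yields both claims:
  \<open>a - b = a' - b'\<close> rearranges to two sums \<open>a + b' = b + a'\<close>, and the
  cardinalities leave room for exactly \<open>R\<close> sums.\<close>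

lemma direct_sum_complete:
  assumes R: "R > 0" and fin: "finite A" "finite A'" and card: "card A * card A' = nat R"
    and zero: "0 \<in> A" "0 \<in> A'"
    and inj: "\<And>a b a' b'. a \<in> A \<Longrightarrow> b \<in> A \<Longrightarrow> a' \<in> A' \<Longrightarrow> b' \<in> A' \<Longrightarrow>
      [a + a' = b + b'] (mod R) \<Longrightarrow> a = b \<and> a' = b'"
  shows "disjoint_differences A A'" "complete_representatives R (direct_sum A A')"
proof -
  have "a - b = 0" if "a \<in> A" "b \<in> A" "a' \<in> A'" "b' \<in> A'" "a - b = a' - b'" for a b a' b'
  proof -
    have "a + b' = b + a'"
      using that by (simp add: algebra_simps)
    then have "[a + b' = b + a'] (mod R)"
      by simp
    then have "a = b"
      using inj that by blast
    then show ?thesis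
      by simp
  qed
  then have "{a - b | a b. a \<in> A \<and> b \<in> A} \<inter> {a - b | a b. a \<in> A' \<and> b \<in> A'} \<subseteq> {0}"
    by blast
  moreover have "0 = 0 - (0 :: int)"
    by simp
  ultimately show "disjoint_differences A A'"
    using zero unfolding disjoint_differences_def by blast
  have sum: "direct_sum A A' = (\<lambda>(a, a'). a + a') ` (A \<times> A')"
    by (auto simp: direct_sum_def)
  have "inj_on (\<lambda>(a, a'). a + a') (A \<times> A')"
  proof (rule inj_onI, clarify)
    fix a a' b b' assume "a \<in> A" "a' \<in> A'" "b \<in> A" "b' \<in> A'" "a + a' = b + b'"
    then show "a = b \<and> a' = b'"
      using inj[of a b a' b'] by simp
  qed
  then have "card (direct_sum A A') = nat R"
    unfolding sum by (simp add: card_image card_cartesian_product card)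
  then show "complete_representatives R (direct_sum A A')"
  proof (rule complete_representativesI[OF R])
    fix s t assume "s \<in> direct_sum A A'" "t \<in> direct_sum A A'" "[s = t] (mod R)"
    then show "s = t"
      using inj by (fastforce simp: direct_sum_def)
  qed
qed

text \<open>The digits are recovered in turn: reduction modulo \<open>g\<close> gives
  \<open>i\<close>, modulo \<open>g * N\<close> the element of \<open>B\<close>, and modulo
  \<open>N * g * h\<close> finally \<open>j\<close>.\<close>

lemma block_complement:
  assumes card: "card B = N" and fin: "finite B" and zero: "0 \<in> B"
    and pos: "N > 0" "g > 0" "h > 0"
    and dvd: "\<And>b. b \<in> B \<Longrightarrow> int g dvd b"
    and inj: "\<And>b b'. b \<in> B \<Longrightarrow> b' \<in> B \<Longrightarrow> [b = b'] (mod int (g * N)) \<Longrightarrow> b = b'"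
  shows "disjoint_differences B (block N g h)"
    "complete_representatives (int (N * g * h)) (direct_sum B (block N g h))"
proof -
  have inj': "a = b \<and> a' = b'"
    if ab: "a \<in> B" "b \<in> B" and ab': "a' \<in> block N g h" "b' \<in> block N g h"
      and c: "[a + a' = b + b'] (mod int (N * g * h))" for a b a' b'
  proof -
    obtain i j where ij: "i < g" "j < h" "a' = int i + int (g * N) * int j"
      using ab'(1) by (rule block_memE)
    obtain i' j' where ij': "i' < g" "j' < h" "b' = int i' + int (g * N) * int j'"
      using ab'(2) by (rule block_memE)
    have "[a + a' = b + b'] (mod int g)"
      using c by (rule cong_dvd_modulus) simp
    then have "a' mod int g = b' mod int g"
      using dvd[OF ab(1)] dvd[OF ab(2)] by (auto elim!: dvdE simp: cong_def)
    then have i: "i = i'"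
      using ij ij' mod_block_element by simp
    have "[a + a' = b + b'] (mod int (g * N))"
      using c by (rule cong_dvd_modulus) simp
    then have "[a = b] (mod int (g * N))"
      unfolding ij(3) ij'(3) i by (simp add: cong_def add.assoc[symmetric] flip: of_nat_mult)
        (simp add: mod_eq_dvd_iff)
    then have "a = b"
      using ab inj by blast
    moreover have "int (g * N) * int h dvd int (g * N) * (int j - int j')"
      using c unfolding ij(3) ij'(3) i \<open>a = b\<close> by (simp add: cong_iff_dvd_diff algebra_simps)
    then have "int h dvd int j - int j'"
      using pos by simp
    then have "j = j'"
      using ij ij' by (simp flip: mod_eq_dvd_iff)
    ultimately show ?thesis
      using ij ij' i by simp
  qed
  have "int (N * g * h) > 0" "card B * card (block N g h) = nat (int (N * g * h))"
    using pos card by (simp_all add: card_block mult.assoc del: of_nat_mult)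
  note * = direct_sum_complete[OF this(1) fin finite_block this(2) zero zero_in_block inj']
  show "disjoint_differences B (block N g h)"
    "complete_representatives (int (N * g * h)) (direct_sum B (block N g h))"
    using * pos by blast+
qed

section \<open>Extreme cycles\<close>

lemma mask_eq_1:
  assumes "finite B" "B \<noteq> {}" "\<And>b. b \<in> B \<Longrightarrow> of_int b * x \<in> \<int>"
  shows "mask B x = 1"
  using assms by (simp add: mask_def cis_2pi_eq_1_iff)

text \<open>Equality in the triangle inequality forces all terms to have the same direction, and the
  term of \<open>0\<close> is \<open>1\<close>.\<close>

lemma norm_mask_eq_1D:
  assumes "finite B" "0 \<in> B" "cmod (mask B x) = 1" "b \<in> B"
  shows "of_int b * x \<in> \<int>"
proof (cases "b = 0")
  case False
  let ?f = "\<lambda>b :: int. cis (2 * pi * (of_int b * x))"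
  have two: "card {0, b} = 2"
    using False by simp
  have sub: "{0, b} \<subseteq> B"
    using assms by simp
  have le: "2 \<le> card B"
    using card_mono[OF assms(1) sub] two by simp
  have "real (card B) = cmod (sum ?f B)"
    using assms le by (simp add: mask_def norm_divide divide_eq_1_iff)
  also have "sum ?f B = sum ?f (B - {0, b}) + sum ?f {0, b}"
    using sum.subset_diff[OF sub assms(1)] .
  also have "cmod \<dots> \<le> cmod (sum ?f (B - {0, b})) + cmod (sum ?f {0, b})"
    by (rule norm_triangle_ineq)
  also have "cmod (sum ?f (B - {0, b})) \<le> real (card (B - {0, b}))"
    using norm_sum[of ?f "B - {0, b}"] by simp
  also have "card (B - {0, b}) = card B - 2"
    using card_Diff_subset[OF _ sub] two by simp
  \<comment> \<open>The other \<open>card B - 2\<close> unimodular terms contribute at most their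
    number, so the pair of \<open>0\<close> and \<open>b\<close> has to contribute
    \<open>2\<close>.\<close>
  finally have "2 \<le> cmod (1 + ?f b)"
    using le False by simp
  then have "4 \<le> (cmod (1 + ?f b))\<^sup>2"
    using power_mono[of 2 "cmod (1 + ?f b)" 2] by simp
  also have "\<dots> = 2 + 2 * cos (2 * pi * (of_int b * x))"
    by (simp add: cmod_power2 power2_sum sin_squared_eq)
  finally have "cos (2 * pi * (of_int b * x)) = 1"
    using cos_le_one[of "2 * pi * (of_int b * x)"] by linarith
  then have "?f b = 1"
    using sin_cos_squared_add[of "2 * pi * (of_int b * x)"] by (simp add: complex_eq_iff)
  then show ?thesis
    by (simp only: cis_2pi_eq_1_iff)
qed simp

lemma cycle_zero:
  assumes "R \<ge> 2" "is_cycle R {0} C"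
  shows "C \<subseteq> {0}"
proof -
  obtain r x and l :: "nat \<Rightarrow> int" where r: "r > 0" and C: "C = x ` {..<r}"
    and step: "\<And>k. k < r \<Longrightarrow> l k = 0 \<and> (x k + of_int (l k)) / of_int R = x (Suc k mod r)"
    using assms(2) unfolding is_cycle_def by auto
  have fin: "finite ((\<lambda>y. \<bar>y\<bar>) ` C)" "(\<lambda>y. \<bar>y\<bar>) ` C \<noteq> {}"
    using C r by auto
  \<comment> \<open>The predecessor of a point is \<open>R\<close> times as large, so a point of largest modulus is zero.\<close>
  define m where "m = Max ((\<lambda>y. \<bar>y\<bar>) ` C)"
  have bound: "\<bar>x k\<bar> \<le> m" if "k < r" for k
    unfolding m_def using that C fin by (intro Max_ge) auto
  have "m \<in> (\<lambda>y. \<bar>y\<bar>) ` C"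
    unfolding m_def using fin by (rule Max_in)
  then obtain k where k: "k < r" "m = \<bar>x k\<bar>"
    using C by auto
  define k' where "k' = (if k = 0 then r - 1 else k - 1)"
  have k': "k' < r" "Suc k' mod r = k"
    using k r by (auto simp: k'_def)
  have "x k' = x k * of_int R"
    using step[OF k'(1)] k'(2) assms(1) by (auto simp: field_simps)
  then have "m * of_int R \<le> m"
    using bound[OF k'(1)] k(2) assms(1) by (simp add: abs_mult)
  moreover have "m * 2 \<le> m * of_int R"
    using k(2) assms(1) by (intro mult_left_mono) auto
  ultimately have "m \<le> 0"
    by linarith
  then have "x i = 0" if "i < r" for i
    using bound[OF that] by simp
  then show ?thesis
    using C by auto
qed

text \<open>Every point of a cycle is \<open>R\<close> times its successor minus an element of
  \<open>L\<close>, so multiplying by \<open>R\<close> already clears all denominators.\<close>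

lemma cycle_integral:
  assumes R: "R \<noteq> 0" and cyc: "is_cycle R L C" and C: "\<And>x. x \<in> C \<Longrightarrow> of_int R * x \<in> \<int>"
  shows "C \<subseteq> \<int>"
proof
  fix y assume "y \<in> C"
  obtain r x l where r: "r > 0" and Cx: "C = x ` {..<r}"
    and step: "\<And>k. k < r \<Longrightarrow> l k \<in> L \<and> (x k + of_int (l k)) / of_int R = x (Suc k mod r)"
    using cyc unfolding is_cycle_def by auto
  obtain k where k: "k < r" "y = x k"
    using \<open>y \<in> C\<close> Cx by auto
  have "x (Suc k mod r) \<in> C"
    using r Cx by auto
  moreover have "y = of_int R * x (Suc k mod r) - of_int (l k)"
    using step[OF k(1)] k(2) R by (auto simp: field_simps)
  ultimately show "y \<in> \<int>"
    using C by simp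
qed

lemma extreme_cycle_block:
  assumes R: "int (N * g * h) \<ge> 2"
    and ext: "extreme_cycle (int (N * g * h)) (block N g h) (block N h g) C"
  shows "C \<subseteq> \<int>"
proof -
  have pos: "N > 0" "g > 0" "h > 0"
    using R by (auto intro!: gr0I)
  have cyc: "is_cycle (int (N * g * h)) (block N h g) C"
    and norm: "\<And>x. x \<in> C \<Longrightarrow> cmod (mask (block N g h) x) = 1"
    using ext by (auto simp: extreme_cycle_def)
  have int: "of_int b * x \<in> \<int>" if "x \<in> C" "b \<in> block N g h" for b x
    using norm_mask_eq_1D[OF finite_block zero_in_block norm] that pos by blast
  \<comment> \<open>Integrality of \<open>b * x\<close> suffices with \<open>b = 1\<close> if
    \<open>g \<ge> 2\<close>, and with \<open>b = N\<close> if \<open>R = N * h\<close> and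
    \<open>h \<ge> 2\<close>. Otherwise the second set of the pair is \<open>{0}\<close>, whose only
    cycle point is \<open>0\<close>.\<close>
  consider "g \<ge> 2" | "g = 1" "h \<ge> 2" | "g = 1" "h = 1"
    using pos by linarith
  then show ?thesis
  proof cases
    case 1
    then have "1 \<in> block N g h"
      using block_memI[of 1 g 0 h N] pos by simp
    then show ?thesis
      using int[of _ 1] by auto
  next
    case 2
    then have "int N \<in> block N g h"
      using block_memI[of 0 g 1 h N] by simp
    then have "of_nat h * (of_nat N * x) \<in> \<int>" if "x \<in> C" for x
      using Ints_mult[OF Ints_of_nat int[OF that, of "int N"]] by simp
    then show ?thesis
      using pos 2 by (intro cycle_integral[OF _ cyc]) (auto simp: mult_ac)
  next
    case 3
    then have "block N h g = {0}"
      by (simp add: block_def lessThan_Suc)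
    then have "C \<subseteq> {0}"
      using cycle_zero[OF R] cyc by simp
    then show ?thesis
      by auto
  qed
qed

text \<open>The mask of \<open>B\<close> equals \<open>1\<close> at all multiples of
  \<open>1 / d\<close>, so every cycle of such fractions is extreme. A cycle with numerators prime
  to \<open>d\<close> then forces \<open>d = 1\<close>. The dynamics is run on the numerators
  \<open>z\<close>.\<close>

lemma Gcd_eq_1_if_extreme_cycles_integral:
  assumes R: "R \<ge> 2" and fin: "finite B" "finite L" and ne: "B \<noteq> {}"
    and rep: "complete_representatives R L" and cop: "coprime (Gcd B) R"
    and ext: "\<And>C. extreme_cycle R B L C \<Longrightarrow> C \<subseteq> \<int>"
  shows "Gcd B = 1"
proof -
  define d where "d = Gcd B"
  have "d \<noteq> 0"
  proof
    assume "d = 0"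
    then have "is_unit R"
      using cop by (simp flip: d_def)
    then show False
      using R by simp
  qed
  then have d: "d > 0"
    using Gcd_int_greater_eq_0[of B] unfolding d_def by linarith
  obtain e where e: "[d * e = 1] (mod R)"
    using cop by (auto simp: d_def dest: cong_solve_coprime_int)
  have "\<exists>l\<in>L. R dvd z + d * l" for z
  proof -
    obtain l where l: "l \<in> L" "[l = - (z * e)] (mod R)"
      using rep unfolding complete_representatives_def by blast
    have "[d * l = d * - (z * e)] (mod R)"
      using l(2) by (rule cong_scalar_left)
    also have "d * - (z * e) = - z * (d * e)"
      by simp
    also have "[- z * (d * e) = - z * 1] (mod R)"
      using e by (rule cong_scalar_left)
    finally have "R dvd z + d * l"
      by (simp add: cong_iff_dvd_diff add.commute)
    then show ?thesis
      using l(1) by blast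
  qed
  then obtain \<gamma> where \<gamma>: "\<And>z. \<gamma> z \<in> L" "\<And>z. R dvd z + d * \<gamma> z"
    by metis
  \<comment> \<open>On numerators the map from \<open>x\<close> to \<open>(x + l) / R\<close>
    becomes \<open>(z + d * l) / R\<close>; the choice \<open>\<gamma> z\<close> of \<open>l\<close>
    keeps it integral.\<close>
  define f where "f z = (z + d * \<gamma> z) div R" for z
  have f: "R * f z = z + d * \<gamma> z" for z
    using \<gamma>(2) by (simp add: f_def)
  define z where "z k = (f ^^ k) 1" for k
  define K where "K = Max ((\<lambda>l. \<bar>d * l\<bar>) ` L)"
  have K: "\<bar>d * \<gamma> y\<bar> \<le> K" for y
    unfolding K_def using fin \<gamma>(1) by (intro Max_ge) auto
  have z_Suc: "R * z (Suc k) = z k + d * \<gamma> (z k)" for k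
    by (simp add: z_def f)
  \<comment> \<open>As \<open>R \<ge> 2\<close>, each step at least halves the sum of
    \<open>\<bar>z k\<bar>\<close> and \<open>K\<close>; the \<open>1\<close> in the bound covers
    the starting point.\<close>
  have bound: "\<bar>z k\<bar> \<le> max K 1" for k
  proof (induction k)
    case (Suc k)
    have "2 * \<bar>z (Suc k)\<bar> \<le> R * \<bar>z (Suc k)\<bar>"
      using R by (intro mult_right_mono) auto
    also have "\<dots> = \<bar>z k + d * \<gamma> (z k)\<bar>"
      using R by (simp flip: z_Suc add: abs_mult)
    also have "\<dots> \<le> max K 1 + K"
      using Suc K[of "z k"] by linarith
    finally show ?case
      by linarith
  qed (simp add: z_def)
  \<comment> \<open>A common divisor of \<open>z (Suc k)\<close> and \<open>d\<close> also divides
    \<open>z k = R * z (Suc k) - d * \<gamma> (z k)\<close>.\<close>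
  have cop_z: "coprime (z k) d" for k
  proof (induction k)
    case (Suc k)
    show ?case
    proof (rule coprimeI)
      fix c assume c: "c dvd z (Suc k)" "c dvd d"
      then have "c dvd z k"
        using z_Suc[of k] by (metis dvd_add_left_iff dvd_mult dvd_mult2)
      then show "is_unit c"
        using c(2) Suc by (auto dest: coprime_common_divisor)
    qed
  qed (simp add: z_def)
  have "range z \<subseteq> {- max K 1..max K 1}"
    using bound by (auto simp: abs_le_iff) (metis minus_le_iff)+
  then have "finite (range z)"
    by (rule finite_subset) simp
  then have "\<not> inj z"
    using finite_imageD infinite_UNIV_nat by blast
  then obtain i j where ij: "i < j" "z i = z j"
    unfolding inj_def by (metis linorder_neqE_nat)
  \<comment> \<open>The repetition \<open>z i = z j\<close> closes the orbit after \<open>r\<close>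
    steps; the part before \<open>i\<close> is discarded.\<close>
  define r where "r = j - i"
  define x where "x k = (of_int (z (i + k)) / of_int d :: real)" for k
  have r: "r > 0"
    using ij by (simp add: r_def)
  have "(x k + of_int (\<gamma> (z (i + k)))) / of_int R = x (Suc k mod r)" if "k < r" for k
  proof -
    have "z (i + Suc k mod r) = z (Suc (i + k))"
    proof (cases "Suc k = r")
      case True
      then have "Suc (i + k) = j"
        using ij by (simp add: r_def)
      then show ?thesis
        using True ij by simp
    next
      case False
      then show ?thesis
        using that by simp
    qed
    then have "of_int R * of_int (z (i + Suc k mod r)) =
        (of_int (z (i + k)) + of_int d * of_int (\<gamma> (z (i + k))) :: real)"
      using z_Suc[of "i + k"] by (simp only: flip: of_int_mult of_int_add)
    then have "of_int (z (i + Suc k mod r)) =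
        (of_int (z (i + k)) + of_int d * of_int (\<gamma> (z (i + k)))) / (of_int R :: real)"
      using R by (simp add: field_simps)
    then show ?thesis
      using d by (simp add: x_def add_divide_distrib mult.commute)
  qed
  then have "is_cycle R L (x ` {..<r})"
    unfolding is_cycle_def using r \<gamma>(1)
    by (intro exI[of _ r] conjI exI[of _ x] exI[of _ "\<lambda>k. \<gamma> (z (i + k))"]) auto
  moreover have "mask B (x k) = 1" for k
  proof (rule mask_eq_1[OF fin(1) ne])
    fix b assume "b \<in> B"
    then have "d dvd b"
      by (simp add: d_def)
    then obtain c where "b = d * c"
      by (auto elim: dvdE)
    then have "of_int b * x k = of_int (c * z (i + k))"
      using d by (simp add: x_def)
    then show "of_int b * x k \<in> \<int>"
      by (simp only: Ints_of_int)
  qed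
  ultimately have "extreme_cycle R B L (x ` {..<r})"
    by (auto simp: extreme_cycle_def)
  then have "x 0 \<in> \<int>"
    using ext r by blast
  then have "d dvd z i"
    using d of_int_div_in_Ints_iff by (simp add: x_def)
  then have "is_unit d"
    using cop_z[of i] by (auto dest: coprime_common_divisor)
  then show ?thesis
    using d by (simp add: d_def)
qed

section \<open>Assembly of the complementary pair\<close>

theorem theorem1p21:
  fixes R :: int and B L :: "int set" and N :: nat
  assumes "R \<ge> 2"
    and "hadamard_pair R B L"
    and "card B = N"
    and "hadamard_equiv N (pair_mat R B L) (standard_hadamard_mat N)"
    and "\<And>C. extreme_cycle R B L C \<Longrightarrow> C \<subseteq> \<int>"
  shows "\<exists>B' L'. hadamard_pair R B' L' \<and> complementary R B L B' L'"
proof -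
  have fin: "finite B" "finite L" and zero: "0 \<in> B" "0 \<in> L" and cardL: "card L = N"
    using assms(2,3) by (auto simp: hadamard_pair_def)
  obtain g h :: nat and b0 l0 :: int
    where pos: "g > 0" "h > 0" and R: "R = int (N * g * h)"
      and dvd: "\<And>b. b \<in> B \<Longrightarrow> int g dvd b" "\<And>l. l \<in> L \<Longrightarrow> int h dvd l"
      and b0: "b0 \<in> B" and l0: "l0 \<in> L" and bl: "[b0 * l0 = int (g * h)] (mod R)"
      and inj: "\<And>b b'. b \<in> B \<Longrightarrow> b' \<in> B \<Longrightarrow> [b = b'] (mod int (g * N)) \<Longrightarrow> b = b'"
        "\<And>l l'. l \<in> L \<Longrightarrow> l' \<in> L \<Longrightarrow> [l = l'] (mod int (h * N)) \<Longrightarrow> l = l'"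
    using standard_equiv_structure[OF assms(2-4)] by blast
  have N: "N > 0"
    using assms(1) R by (auto intro: gr0I)
  let ?B' = "block N g h" and ?L' = "block N h g"
  have B: "disjoint_differences B ?B'" "complete_representatives R (direct_sum B ?B')"
    using block_complement[OF assms(3) fin(1) zero(1) N pos dvd(1) inj(1)] R by auto
  have L: "disjoint_differences L ?L'" "complete_representatives R (direct_sum L ?L')"
    using block_complement[OF cardL fin(2) zero(2) N pos(2,1) dvd(2) inj(2)] R by (auto simp: ac_simps)
  have sub: "B \<subseteq> direct_sum B ?B'" "?B' \<subseteq> direct_sum B ?B'"
    using zero(1) zero_in_block[OF pos, of N] by (force simp: direct_sum_def)+
  \<comment> \<open>With \<open>g = 1\<close>, cancelling \<open>h\<close> from
    \<open>b0 * l0 = h\<close> modulo \<open>N * h\<close> exhibits an inverse of \<open>b0\<close>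
    modulo \<open>N\<close>.\<close>
  have cop: "coprime b0 (int N)" if "g = 1"
  proof (rule coprimeI)
    fix c assume c: "c dvd b0" "c dvd int N"
    have "int h dvd l0"
      using dvd l0 by blast
    then obtain m where m: "l0 = int h * m"
      by (auto elim: dvdE)
    have "int h * int N dvd int h * (b0 * m - 1)"
      using bl by (simp add: cong_iff_dvd_diff m R that algebra_simps)
    then have "int N dvd b0 * m - 1"
      using pos by simp
    then have "c dvd b0 * m - 1"
      using c(2) dvd_trans by blast
    then show "is_unit c"
      using c(1) by (metis diff_diff_cancel dvd_diff dvd_mult2 diff_add_cancel dvd_add_right_iff)
  qed
  have "Gcd (direct_sum B ?B') = 1"
  proof -
    \<comment> \<open>The sum contains \<open>1\<close> in the first case, and the coprime numbers
      \<open>N\<close> and \<open>b0\<close> in the second. In the third it is \<open>B\<close>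
      itself, and the integrality of the extreme cycles decides.\<close>
    consider "g \<ge> 2" | "g = 1" "h \<ge> 2" | "g = 1" "h = 1"
      using pos by linarith
    then show ?thesis
    proof cases
      case 1
      then have "1 \<in> direct_sum B ?B'"
        using block_memI[of 1 g 0 h N] pos sub by auto
      then show ?thesis
        by (metis Gcd_dvd Gcd_int_greater_eq_0 zdvd1_eq abs_of_nonneg)
    next
      case 2
      then have "int N \<in> direct_sum B ?B'"
        using block_memI[of 0 g 1 h N] sub by auto
      then have "Gcd (direct_sum B ?B') dvd int N" "Gcd (direct_sum B ?B') dvd b0"
        using b0 sub by auto
      then have "is_unit (Gcd (direct_sum B ?B'))"
        using cop[OF 2(1)] coprime_common_divisor by blast
      then show ?thesis
        by (metis Gcd_int_greater_eq_0 zdvd1_eq abs_of_nonneg)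
    next
      case 3
      then have "?B' = {0}" "?L' = {0}"
        by (simp_all add: block_def lessThan_Suc)
      then have "direct_sum B ?B' = B" "direct_sum L ?L' = L"
        by (auto simp: direct_sum_def)
      \<comment> \<open>Here \<open>R = N\<close>, and \<open>Gcd B\<close> divides
        \<open>b0\<close>, which is prime to \<open>N\<close>.\<close>
      moreover have "coprime (Gcd B) R"
        using coprime_divisors[OF Gcd_dvd[OF b0] dvd_refl cop] 3 R by simp
      ultimately show ?thesis
        using Gcd_eq_1_if_extreme_cycles_integral[OF assms(1) fin _ _ _ assms(5)] L zero by auto
    qed
  qed
  moreover have "hadamard_pair R ?B' ?L'"
    using hadamard_pair_block assms(1) unfolding R by blast
  moreover have "C \<subseteq> \<int>" if "extreme_cycle R ?B' ?L' C" for C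
    using extreme_cycle_block that assms(1) unfolding R by blast
  ultimately show ?thesis
    using assms(2,5) B L unfolding complementary_def by blast
qed

end
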